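(* Let $\alpha>0$, $\beta\ge 0$, and let $z\in\mathbb{C}\setminus\{0\}$ with $|\arg z|<\pi$. Let the Mittag-Leffler function $E_{\alpha,\beta}(z)=\sum_{k=0}^\infty \frac{z^k}{\Gamma(\alpha k+\beta)}$ be represented by the Mellin-Barnes integral $$E_{\alpha,\beta}(z) = \frac{1}{2 \pi i} \int_{\mathcal{L}_{-\infty}} \frac{\Gamma(s)\, \Gamma(1 - s)}{\Gamma(\beta - \alpha s)}\, (- z)^{-s}\, ds .$$ Then $E_{\alpha,\beta}(z)$ is differentiable with respect to the parameters $\alpha$ and $\beta$, and for all $\alpha>0$, $\beta\ge 0$, $$\frac{\partial E_{\alpha,\beta}(z)}{\partial \alpha} = \frac{1}{2 \pi i} \int_{\mathcal{L}_{-\infty}} \frac{s\, \psi(\beta - \alpha s)\, \Gamma(s)\, \Gamma(1 - s)}{\Gamma(\beta - \alpha s)}\, (- z)^{-s}\, ds,$$ $$\frac{\partial E_{\alpha,\beta}(z)}{\partial \beta} = - \frac{1}{2 \pi i} \int_{\mathcal{L}_{-\infty}} \frac{\psi(\beta - \alpha s)\, \Gamma(s)\, \Gamma(1 - s)}{\Gamma(\beta - \alpha s)}\, (- z)^{-s}\, ds .$$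
   Context: $\psi=\Gamma'/\Gamma$ is the digamma function; $1/\Gamma$ is understood as an entire function and $\psi(w)/\Gamma(w)$ as the entire function $-(1/\Gamma)'(w)$. The contour $\mathcal{L}_{-\infty}$ is a loop which starts at $-\infty-i\varphi$ and ends at $-\infty+i\varphi$ with a fixed sufficiently small $\varphi>0$, crossing the real line (once) at a point $c$ with $0<c<1$ (for instance: the half-line $\mathrm{Im}\,s=-\varphi$, $\mathrm{Re}\,s\le c$ traversed to the right, then the segment from $c-i\varphi$ to $c+i\varphi$, then the half-line $\mathrm{Im}\,s=\varphi$, $\mathrm{Re}\,s\le c$ traversed to the left); it leaves all poles $s=0,-1,-2,\ldots$ of $\Gamma(s)$ to the left and all poles $s=1,2,3,\ldots$ of $\Gamma(1-s)$ to the right. The power is $(-z)^{-s}=\exp\{-s[\log|z|+i\arg(-z)]\}$, where $\arg(-z)$ is an arbitrarily chosen branch of the argument (e.g. the principal one). *)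

theory Defs
  imports "HOL-Complex_Analysis.Complex_Analysis"
begin

text \<open>
  \<open>rGamma\<close> is the library's entire function \<open>1 / \<Gamma>\<close>. The series makes sense for every
  real \<open>\<beta>\<close>, so a derivative with respect to \<open>\<beta>\<close> at \<open>\<beta> = 0\<close> can be taken two-sidedly.
\<close>
definition mittag_leffler :: "real \<Rightarrow> real \<Rightarrow> complex \<Rightarrow> complex" where
  "mittag_leffler \<alpha> \<beta> z = (\<Sum>k. z ^ k * rGamma (of_real (\<alpha> * real k + \<beta>)))"

text \<open>
  The entire function \<open>\<psi> / \<Gamma>\<close>, that is \<open>- (1 / \<Gamma>)'\<close>. The quotient of the library's
  \<open>Digamma\<close> and \<open>Gamma\<close> has the wrong values at the poles of \<open>\<Gamma>\<close>.
\<close>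
definition Digamma_rGamma :: "complex \<Rightarrow> complex" where
  "Digamma_rGamma w = - deriv rGamma w"

lemma Digamma_rGamma_eq:
  assumes "w \<notin> \<int>\<^sub>\<le>\<^sub>0"
  shows "Digamma_rGamma w = Digamma w / Gamma w"
proof -
  have "(rGamma has_field_derivative (- rGamma w * Digamma w)) (at w)"
    using assms by (rule has_field_derivative_rGamma_no_nonpos_int)
  then show ?thesis
    by (simp add: Digamma_rGamma_def DERIV_imp_deriv rGamma_inverse_Gamma field_simps)
qed

text \<open>
  The power \<open>(- z) powr (- s)\<close> for the branch on which \<open>\<theta>\<close> is the argument of \<open>- z\<close>;
  it is meant to be used under the assumption \<open>is_Arg (- z) \<theta>\<close>.
\<close>
definition neg_power :: "complex \<Rightarrow> real \<Rightarrow> complex \<Rightarrow> complex" where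
  "neg_power z \<theta> s = exp (- s * (of_real (ln (norm z)) + \<i> * of_real \<theta>))"

text \<open>
  A loop from \<open>- \<infinity> - \<i> \<phi>\<close> to \<open>- \<infinity> + \<i> \<phi>\<close> consists of the half-line
  \<open>Im s = - \<phi>, Re s \<le> a\<close> traversed to the right, a finite piece \<open>g\<close>, and the half-line
  \<open>Im s = \<phi>, Re s \<le> a\<close> traversed to the left. As the real line is crossed exactly once, from
  below to above and strictly between \<open>0\<close> and \<open>1\<close>, the points \<open>0, -1, -2, \<dots>\<close> lie to the left
  of the loop and the points \<open>1, 2, 3, \<dots>\<close> to the right.
\<close>
definition left_loop :: "real \<Rightarrow> real \<Rightarrow> real \<Rightarrow> (real \<Rightarrow> complex) \<Rightarrow> bool" where
  "left_loop \<phi> c a g \<longleftrightarrow>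
     0 < \<phi> \<and> 0 < c \<and> c < 1 \<and>
     valid_path g \<and> pathstart g = Complex a (- \<phi>) \<and> pathfinish g = Complex a \<phi> \<and>
     (\<exists>!t. t \<in> {0..1} \<and> Im (g t) = 0) \<and>
     (\<forall>t\<in>{0..1}. Im (g t) = 0 \<longrightarrow> g t = of_real c)"

lemma left_loop_linepath:
  assumes "0 < \<phi>" "0 < c" "c < 1"
  shows "left_loop \<phi> c c (linepath (Complex c (- \<phi>)) (Complex c \<phi>))"
proof -
  have im: "Im (linepath (Complex c (- \<phi>)) (Complex c \<phi>) t) = \<phi> * (2 * t - 1)" for t
    by (simp add: linepath_def algebra_simps)
  have re: "Re (linepath (Complex c (- \<phi>)) (Complex c \<phi>) t) = c" for t
    by (simp add: linepath_def algebra_simps)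
  have "\<exists>!t. t \<in> {0..1} \<and> \<phi> * (2 * t - 1) = 0"
    by (rule ex1I[of _ "1/2"]) (use assms in auto)
  then show ?thesis
    using assms by (simp add: left_loop_def im re complex_eq_iff)
qed

text \<open>
  The integrals over the half-lines are improper; Henstock-Kurzweil integrability on \<open>{..a}\<close>
  expresses that they converge.
\<close>
definition loop_integrable ::
  "real \<Rightarrow> real \<Rightarrow> (real \<Rightarrow> complex) \<Rightarrow> (complex \<Rightarrow> complex) \<Rightarrow> bool" where
  "loop_integrable \<phi> a g f \<longleftrightarrow>
     (\<lambda>x. f (Complex x (- \<phi>))) integrable_on {..a} \<and>
     f contour_integrable_on g \<and>
     (\<lambda>x. f (Complex x \<phi>)) integrable_on {..a}"

definition loop_integral ::
  "real \<Rightarrow> real \<Rightarrow> (real \<Rightarrow> complex) \<Rightarrow> (complex \<Rightarrow> complex) \<Rightarrow> complex" where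
  "loop_integral \<phi> a g f =
     integral {..a} (\<lambda>x. f (Complex x (- \<phi>))) + contour_integral g f
       - integral {..a} (\<lambda>x. f (Complex x \<phi>))"

end

theory Submission
  imports Defs "HOL-Real_Asymp.Real_Asymp"
begin

text \<open>
  All three integrals have the form \<open>\<integral> \<Gamma>(s) \<Gamma>(1 - s) h(s) ds\<close> with \<open>h\<close> entire. On horizontal strips
  \<open>1 / \<Gamma>\<close> and, by Cauchy's inequality, its derivative decay faster than every exponential to the
  right, so \<open>h(s) = O(exp (Re s))\<close> to the left. As \<open>\<Gamma>(s) \<Gamma>(1 - s) = \<pi> / sin (\<pi> s)\<close> has residue
  \<open>(-1)\<^sup>k\<close> at \<open>-k\<close>, such a loop integral is \<open>2 \<pi> \<i> \<Sum> (-1)\<^sup>k h(-k)\<close>. These residue series are the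
  Mittag-Leffler series and its termwise derivatives with respect to the parameters; the same
  decay gives the uniform convergence needed to differentiate termwise.
\<close>

section \<open>Superexponential decay on horizontal strips\<close>

text \<open>The rate \<open>A\<close> is an arbitrary real number and \<open>C\<close> may depend on
  it: this is decay faster than every exponential as Re w grows. As \<open>B\<close> and
  \<open>L\<close> are arbitrary too, enlarging the strip and substituting w = \<beta> - \<alpha> s
  only change constants.\<close>

definition strip_decay :: "(complex \<Rightarrow> complex) \<Rightarrow> bool" where
  "strip_decay P \<longleftrightarrow>
     (\<forall>A B L. \<exists>C\<ge>0. \<forall>w. \<bar>Im w\<bar> \<le> B \<longrightarrow> L \<le> Re w \<longrightarrow> norm (P w) \<le> C * exp (A * Re w))"

lemma strip_decayE:
  assumes "strip_decay P"
  obtains C where "C \<ge> 0"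
    "\<And>w. \<bar>Im w\<bar> \<le> B \<Longrightarrow> L \<le> Re w \<Longrightarrow> norm (P w) \<le> C * exp (A * Re w)"
  using assms unfolding strip_decay_def by blast

text \<open>The recursion \<open>rGamma (w - 1) = (w - 1) * rGamma w\<close> gains more than the factor
  \<open>exp (- A)\<close> per unit step as soon as \<open>Re w\<close> is large.\<close>
lemma strip_decay_rGamma: "strip_decay rGamma"
  unfolding strip_decay_def
proof (intro allI)
  fix A B L :: real
  \<comment> \<open>If Re w > N + 1, then w - 1 has modulus at least \<open>exp (- A)\<close> and
    still satisfies Re (w - 1) \<ge> L, so a unit step to the left is possible. The remaining box
    \<open>?K\<close> is compact.\<close>
  obtain N :: nat where N: "real N \<ge> max (exp (- A)) L"
    using real_arch_simple by blast
  let ?K = "cbox (Complex L (- B)) (Complex (real N + 1) B)"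
  have "continuous_on ?K (\<lambda>w. rGamma w * exp (- (of_real A * of_real (Re w))))"
    by (intro continuous_intros)
  then have "bounded ((\<lambda>w. rGamma w * exp (- (of_real A * of_real (Re w)))) ` ?K)"
    by (intro compact_imp_bounded compact_continuous_image) auto
  then obtain C where "C > 0"
    and C: "\<forall>w\<in>?K. norm (rGamma w * exp (- (of_real A * of_real (Re w)))) \<le> C"
    unfolding bounded_pos by auto
  have step: "norm (rGamma w) \<le> C * exp (A * Re w)"
    if "\<bar>Im w\<bar> \<le> B" "L \<le> Re w" "Re w \<le> real N + 1 + real m" for m w
    using that
  proof (induction m arbitrary: w)
    case 0
    then have "w \<in> ?K"
      by (auto simp: in_cbox_complex_iff)
    then have "norm (rGamma w) * exp (- (A * Re w)) \<le> C"
      using C by (force simp: norm_mult)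
    then show ?case
      by (simp add: exp_minus field_simps)
  next
    case (Suc m)
    show ?case
    proof (cases "Re w \<le> real N + 1 + real m")
      case True
      then show ?thesis
        using Suc by blast
    next
      case False
      have "norm (rGamma w) * exp (- A) \<le> norm (rGamma w) * norm (w - 1)"
      proof (intro mult_left_mono)
        have "exp (- A) \<le> Re (w - 1)"
          using N False by simp
        then show "exp (- A) \<le> norm (w - 1)"
          using complex_Re_le_cmod order_trans by blast
      qed auto
      also have "\<dots> = norm (rGamma (w - 1))"
        using rGamma_plus1[of "w - 1"] by (simp add: norm_mult[symmetric] mult.commute)
      also have "\<dots> \<le> C * exp (A * Re (w - 1))"
        using Suc.prems False N by (intro Suc.IH) auto
      finally show ?thesis
        by (simp add: algebra_simps exp_diff exp_minus field_simps)
    qed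
  qed
  have "norm (rGamma w) \<le> C * exp (A * Re w)" if "\<bar>Im w\<bar> \<le> B" "L \<le> Re w" for w
  proof -
    obtain m :: nat where "Re w \<le> real m"
      using real_arch_simple by blast
    then show ?thesis
      using that by (intro step[of _ m]) auto
  qed
  then show "\<exists>C\<ge>0. \<forall>w. \<bar>Im w\<bar> \<le> B \<longrightarrow> L \<le> Re w \<longrightarrow> norm (rGamma w) \<le> C * exp (A * Re w)"
    using \<open>C > 0\<close> by (intro exI[of _ C]) auto
qed

text \<open>Cauchy's inequality on the unit circle around w. The circle stays in the region with
  \<open>B + 1\<close> and \<open>L - 1\<close>, and on it \<open>exp (A * Re x)\<close> exceeds
  \<open>exp (A * Re w)\<close> by at most the factor \<open>exp \<bar>A\<bar>\<close>.\<close>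

lemma strip_decay_deriv:
  assumes "strip_decay P" and holo: "P holomorphic_on UNIV"
  shows "strip_decay (deriv P)"
  unfolding strip_decay_def
proof (intro allI)
  fix A B L :: real
  obtain C where "C \<ge> 0"
    and C: "\<And>w. \<bar>Im w\<bar> \<le> B + 1 \<Longrightarrow> L - 1 \<le> Re w \<Longrightarrow> norm (P w) \<le> C * exp (A * Re w)"
    using strip_decayE[OF assms(1), of "B + 1" "L - 1" A] by blast
  have "norm (deriv P w) \<le> C * exp \<bar>A\<bar> * exp (A * Re w)" if w: "\<bar>Im w\<bar> \<le> B" "L \<le> Re w" for w
  proof -
    have "norm (P x) \<le> C * exp \<bar>A\<bar> * exp (A * Re w)" if "norm (w - x) = 1" for x
    proof -
      have le: "\<bar>Re x - Re w\<bar> \<le> 1" "\<bar>Im x - Im w\<bar> \<le> 1"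
        using abs_Re_le_cmod[of "w - x"] abs_Im_le_cmod[of "w - x"] that by auto
      have "A * (Re x - Re w) \<le> \<bar>A\<bar>"
        using mult_left_mono[OF le(1), of "\<bar>A\<bar>"] by (simp flip: abs_mult)
      then have "A * Re x \<le> \<bar>A\<bar> + A * Re w"
        by (simp add: algebra_simps)
      then have "C * exp (A * Re x) \<le> C * exp (\<bar>A\<bar> + A * Re w)"
        using \<open>C \<ge> 0\<close> by (intro mult_left_mono) auto
      moreover have "norm (P x) \<le> C * exp (A * Re x)"
        using le w by (intro C) linarith+
      ultimately show ?thesis
        by (simp add: exp_add mult.assoc)
    qed
    then have "norm ((deriv ^^ 1) P w) \<le> fact 1 * (C * exp \<bar>A\<bar> * exp (A * Re w)) / 1 ^ 1"
      using holo by (intro Cauchy_inequality)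
        (auto intro: holomorphic_on_subset holomorphic_on_imp_continuous_on continuous_on_subset)
    then show ?thesis
      by simp
  qed
  then show "\<exists>C\<ge>0. \<forall>w. \<bar>Im w\<bar> \<le> B \<longrightarrow> L \<le> Re w \<longrightarrow> norm (deriv P w) \<le> C * exp (A * Re w)"
    using \<open>C \<ge> 0\<close> by (intro exI[of _ "C * exp \<bar>A\<bar>"]) auto
qed

section \<open>Improper integrals over a left half-line\<close>

text \<open>Dominated convergence with majorant \<open>M * exp x\<close> gives both claims. The
  cut-offs -(n + 1/2) lie midway between consecutive poles; the rectangles used later have their
  left sides there.\<close>

lemma
  fixes f :: "real \<Rightarrow> complex"
  assumes cont: "continuous_on {..a} f" and bound: "\<And>x. x \<le> a \<Longrightarrow> norm (f x) \<le> M * exp x"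
  shows integrable_on_atMost_exp_bound: "f integrable_on {..a}"
    and tendsto_integral_atMost_exp_bound:
      "(\<lambda>n. integral {- (real n + 1/2)..a} f) \<longlonglongrightarrow> integral {..a} f"
proof -
  define F where "F n x = (if x \<in> {- (real n + 1/2)..a} then f x else 0)" for n :: nat and x
  have "(\<lambda>x::real. exp (- x)) absolutely_integrable_on {- a..}"
    using integrable_on_exp_minus_to_infinity[of 1 "- a"]
    by (intro nonnegative_absolutely_integrable_1) auto
  then have "(\<lambda>x::real. exp x) absolutely_integrable_on {..a}"
    using has_absolute_integral_reflect_real[of "{..a}" "{- a..}" "\<lambda>x::real. exp (- x)"] by force
  then have exp: "(\<lambda>x. M * exp x) integrable_on {..a}"
    by (intro integrable_on_mult_right) (simp add: absolutely_integrable_on_def)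
  have "f integrable_on {- (real n + 1/2)..a}" for n
    by (intro integrable_continuous_interval continuous_on_subset[OF cont]) auto
  then have int: "F n integrable_on {..a}" for n
    unfolding F_def by (subst integrable_restrict_Int) (simp add: Int_absorb2)
  \<comment> \<open>Where \<open>F n x\<close> is 0 the majorant has to be nonnegative; this comes
    from the bound on \<open>norm (f x)\<close>.\<close>
  have le: "norm (F n x) \<le> M * exp x" if "x \<in> {..a}" for n x
    using bound[of x] that norm_ge_zero[of "f x"] by (auto simp: F_def simp del: norm_ge_zero)
  have lim: "(\<lambda>n. F n x) \<longlonglongrightarrow> f x" if "x \<in> {..a}" for x
  proof (rule tendsto_eventually)
    obtain m :: nat where "- x \<le> real m"
      using real_arch_simple by blast
    then have "\<forall>n\<ge>m. F n x = f x"
      using that by (auto simp: F_def)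
    then show "\<forall>\<^sub>F n in sequentially. F n x = f x"
      unfolding eventually_sequentially by blast
  qed
  note dominated_convergence[OF int exp le lim]
  moreover have "integral {..a} (F n) = integral {- (real n + 1/2)..a} f" for n
    unfolding F_def by (subst integral_restrict_Int) (simp add: Int_absorb2)
  ultimately show "f integrable_on {..a}"
    "(\<lambda>n. integral {- (real n + 1/2)..a} f) \<longlonglongrightarrow> integral {..a} f"
    by simp_all
qed

section \<open>Termwise differentiation in a parameter\<close>

text \<open>Affine arguments \<open>p k + q k * x\<close> cover both parameters: \<open>q k\<close>
  is k for \<alpha> and 1 for \<beta>. Their lower bound, linear in k and uniform on
  \<open>S\<close>, turns superexponential decay into a geometric majorant; \<open>L\<close> admits
  negative arguments, hence a neighbourhood of \<beta> = 0.\<close>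

lemma has_vector_derivative_suminf_rGamma:
  fixes p q :: "nat \<Rightarrow> real" and z :: complex
  assumes S: "convex S" "open S" "t \<in> S" and "\<delta> > 0"
    and ge: "\<And>k x. x \<in> S \<Longrightarrow> \<delta> * real k - L \<le> p k + q k * x"
    and q: "\<And>k. \<bar>q k\<bar> \<le> real k + 1"
  shows "((\<lambda>x. \<Sum>k. z ^ k * rGamma (of_real (p k + q k * x))) has_vector_derivative
           (\<Sum>k. z ^ k * of_real (q k) * deriv rGamma (of_real (p k + q k * t)))) (at t)"
proof -
  \<comment> \<open>At this rate decay contributes
    \<open>exp (- (\<bar>ln (norm z)\<bar> + 2) * k)\<close>: the logarithm absorbs
    \<open>z ^ k\<close>, one unit absorbs the factor k + 1, and the other leaves the ratio
    \<open>exp (- 1)\<close>.\<close>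
  define A where "A = - (\<bar>ln (norm z)\<bar> + 2) / \<delta>"
  define f where "f k x = z ^ k * rGamma (of_real (p k + q k * x))" for k and x :: real
  define f' where "f' k x = z ^ k * of_real (q k) * deriv rGamma (of_real (p k + q k * x))"
    for k and x :: real
  have "A \<le> 0"
    using \<open>\<delta> > 0\<close> by (simp add: A_def field_simps)
  have summable: "summable (\<lambda>k. C * exp (- 1) ^ k)" for C :: real
    by (intro summable_mult summable_geometric) auto
  have key: "norm (z ^ k) * (real k + 1) * exp (A * (p k + q k * x)) \<le> exp (- (A * L)) * exp (- 1) ^ k"
    if "x \<in> S" for k x
  proof -
    have "norm z \<le> exp \<bar>ln (norm z)\<bar>"
    proof (cases "z = 0")
      case False
      then have "norm z = exp (ln (norm z))"
        by simp
      also have "\<dots> \<le> exp \<bar>ln (norm z)\<bar>"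
        by simp
      finally show ?thesis .
    qed simp
    then have "norm (z ^ k) \<le> exp \<bar>ln (norm z)\<bar> ^ k"
      by (simp add: norm_power power_mono)
    moreover have "real k + 1 \<le> exp 1 ^ k"
      using exp_ge_add_one_self[of "real k"] by (simp add: exp_of_nat_mult[symmetric] add.commute)
    moreover have "exp (A * (p k + q k * x)) \<le> exp (A * (\<delta> * real k - L))"
      using mult_left_mono_neg[OF ge[OF that, of k] \<open>A \<le> 0\<close>] by simp
    ultimately have "norm (z ^ k) * (real k + 1) * exp (A * (p k + q k * x))
        \<le> exp \<bar>ln (norm z)\<bar> ^ k * exp 1 ^ k * exp (A * (\<delta> * real k - L))"
      by (intro mult_mono) auto
    also have "\<dots> = exp (\<bar>ln (norm z)\<bar> * real k + real k + A * (\<delta> * real k - L))"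
      by (simp add: exp_add exp_of_nat2_mult flip: exp_of_nat_mult)
    also have "\<bar>ln (norm z)\<bar> * real k + real k + A * (\<delta> * real k - L) = - (A * L) + - 1 * real k"
      using \<open>\<delta> > 0\<close> by (simp add: A_def field_simps)
    also have "exp \<dots> = exp (- (A * L)) * exp (- 1) ^ k"
      by (simp only: exp_add exp_of_nat2_mult)
    finally show ?thesis .
  qed
  have L: "- L \<le> p k + q k * x" if "x \<in> S" for k x
    using ge[OF that, of k] mult_nonneg_nonneg[of \<delta> "real k"] \<open>\<delta> > 0\<close> by linarith
  \<comment> \<open>All arguments are real, so the degenerate strip Im w = 0 is enough.\<close>
  obtain C where C: "C \<ge> 0"
    "\<And>w. \<bar>Im w\<bar> \<le> 0 \<Longrightarrow> - L \<le> Re w \<Longrightarrow> norm (rGamma w) \<le> C * exp (A * Re w)"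
    using strip_decayE[OF strip_decay_rGamma] by blast
  obtain D where D: "D \<ge> 0"
    "\<And>w. \<bar>Im w\<bar> \<le> 0 \<Longrightarrow> - L \<le> Re w \<Longrightarrow> norm (deriv rGamma w) \<le> D * exp (A * Re w)"
    using strip_decayE[OF strip_decay_deriv[OF strip_decay_rGamma holomorphic_rGamma]] by blast
  have f_le: "norm (f k x) \<le> C * exp (- (A * L)) * exp (- 1) ^ k" if "x \<in> S" for k x
  proof -
    have "norm (f k x) \<le> norm (z ^ k) * (C * exp (A * (p k + q k * x)))"
      unfolding f_def norm_mult using C(2)[of "of_real (p k + q k * x)"] L[OF that, of k]
      by (intro mult_left_mono) auto
    \<comment> \<open>The factor k + 1 \<ge> 1 is inserted so that \<open>key\<close> serves the
      terms as well as their derivatives.\<close>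
    also have "\<dots> \<le> C * (norm (z ^ k) * (real k + 1) * exp (A * (p k + q k * x)))"
      using mult_right_mono[of 1 "real k + 1" "C * (norm (z ^ k) * exp (A * (p k + q k * x)))"] C(1)
      by (simp add: mult_ac)
    also have "\<dots> \<le> C * (exp (- (A * L)) * exp (- 1) ^ k)"
      using C(1) key[OF that] by (intro mult_left_mono) auto
    finally show ?thesis
      by (simp add: mult_ac)
  qed
  have f'_le: "norm (f' k x) \<le> D * exp (- (A * L)) * exp (- 1) ^ k" if "x \<in> S" for k x
  proof -
    have "norm (f' k x) \<le> norm (z ^ k) * (real k + 1) * (D * exp (A * (p k + q k * x)))"
      unfolding f'_def norm_mult using D(2)[of "of_real (p k + q k * x)"] L[OF that, of k] q
      by (intro mult_mono) auto
    also have "\<dots> \<le> D * (exp (- (A * L)) * exp (- 1) ^ k)"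
      using mult_left_mono[OF key[OF that, of k] D(1)] by (simp add: mult_ac)
    finally show ?thesis
      by (simp add: mult_ac)
  qed
  have deriv: "(f k has_vector_derivative f' k x) (at x)" for k x
  proof -
    have "(rGamma has_field_derivative deriv rGamma w) (at w)" for w :: complex
      using holomorphic_rGamma[of UNIV] by (intro holomorphic_derivI[of _ UNIV]) auto
    moreover have "((\<lambda>x. complex_of_real (p k + q k * x)) has_vector_derivative of_real (q k)) (at x)"
      by (auto intro!: derivative_eq_intros)
    ultimately have "(rGamma \<circ> (\<lambda>x. complex_of_real (p k + q k * x)) has_vector_derivative
        of_real (q k) * deriv rGamma (of_real (p k + q k * x))) (at x)"
      by (intro field_vector_diff_chain_at)
    then show ?thesis
      unfolding f_def f'_def by (auto intro!: derivative_eq_intros simp: o_def)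
  qed
  have unif: "uniform_limit S (\<lambda>n x. \<Sum>i<n. f' i x) (\<lambda>x. \<Sum>i. f' i x) sequentially"
    by (rule Weierstrass_m_test[OF f'_le summable])
  \<comment> \<open>This yields some sum function with a derivative within \<open>S\<close>;
    uniqueness of sums and openness of \<open>S\<close> then give the claim.\<close>
  have "\<exists>g. \<forall>x\<in>S. (\<lambda>n. f n x) sums (g x) \<and>
          (g has_derivative (\<lambda>h. h *\<^sub>R (\<Sum>i. f' i x))) (at x within S)"
  proof (rule has_derivative_series[OF S(1) _ _ S(3)])
    show "(f n has_derivative (\<lambda>h. h *\<^sub>R f' n x)) (at x within S)" for n x
      using deriv by (metis has_vector_derivative_def has_vector_derivative_at_within)
    show "(\<lambda>n. f n t) sums (\<Sum>n. f n t)"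
      using summable_comparison_test'[OF summable f_le[OF S(3)]] by (rule summable_sums)
    fix e :: real
    assume "e > 0"
    with unif have "\<forall>\<^sub>F n in sequentially. \<forall>x\<in>S. norm ((\<Sum>i<n. f' i x) - (\<Sum>i. f' i x)) < e"
      by (simp add: uniform_limit_iff dist_norm)
    then show "\<forall>\<^sub>F n in sequentially. \<forall>x\<in>S. \<forall>h.
        norm ((\<Sum>i<n. h *\<^sub>R f' i x) - h *\<^sub>R (\<Sum>i. f' i x)) \<le> e * norm h"
    proof (rule eventually_mono, intro ballI allI)
      fix n x and h :: real
      assume "\<forall>x\<in>S. norm ((\<Sum>i<n. f' i x) - (\<Sum>i. f' i x)) < e" "x \<in> S"
      then have "norm h * norm ((\<Sum>i<n. f' i x) - (\<Sum>i. f' i x)) \<le> norm h * e"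
        by (intro mult_left_mono) (auto simp: less_imp_le)
      then show "norm ((\<Sum>i<n. h *\<^sub>R f' i x) - h *\<^sub>R (\<Sum>i. f' i x)) \<le> e * norm h"
        by (simp add: scaleR_right.sum[symmetric] scaleR_diff_right[symmetric] mult.commute
            del: scaleR_right_diff_distrib)
    qed
  qed
  then obtain g where g: "\<And>x. x \<in> S \<Longrightarrow> (\<lambda>n. f n x) sums (g x)"
    "\<And>x. x \<in> S \<Longrightarrow> (g has_vector_derivative (\<Sum>i. f' i x)) (at x within S)"
    unfolding has_vector_derivative_def by blast
  have "(g has_vector_derivative (\<Sum>i. f' i t)) (at t)"
    using g(2)[OF S(3)] at_within_open[OF S(3,2)] by simp
  then have "((\<lambda>x. \<Sum>k. f k x) has_vector_derivative (\<Sum>i. f' i t)) (at t)"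
    by (rule has_vector_derivative_transform_within_open[OF _ S(2,3)]) (use g(1) in \<open>auto simp: sums_iff\<close>)
  then show ?thesis
    by (simp add: f_def f'_def)
qed

section \<open>The slit plane and the residues of \<pi> / sin (\<pi> s)\<close>

text \<open>The plane without the real rays up to 0 and from 1 on. It contains the loop but no pole
  of \<pi> / sin (\<pi> s), and its star shape provides a single-valued primitive.\<close>

definition slit_plane :: "complex set" where
  "slit_plane = {s. Im s \<noteq> 0 \<or> 0 < Re s \<and> Re s < 1}"

lemma open_slit_plane: "open slit_plane"
proof -
  have eq: "slit_plane = {s. Im s < 0} \<union> {s. Im s > 0} \<union> ({s. 0 < Re s} \<inter> {s. Re s < 1})"
    by (auto simp: slit_plane_def)
  show ?thesis
    unfolding eq by (intro open_Un open_Int open_halfspace_Re_gt open_halfspace_Re_lt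
        open_halfspace_Im_gt open_halfspace_Im_lt)
qed

text \<open>A segment from 1/2 to a nonreal point leaves the real axis at once; one to a real point
  of the set stays in the gap between 0 and 1.\<close>

lemma starlike_slit_plane: "starlike slit_plane"
  unfolding starlike_def
proof (intro bexI ballI subsetI)
  show half: "1/2 \<in> slit_plane"
    by (simp add: slit_plane_def)
  fix x y :: complex
  assume x: "x \<in> slit_plane" and y: "y \<in> closed_segment (1/2) x"
  show "y \<in> slit_plane"
  proof (cases "Im x = 0")
    case True
    let ?S = "{s. 0 < Re s} \<inter> {s. Re s < 1}"
    have "convex ?S"
      by (intro convex_Int convex_halfspace_Re_gt convex_halfspace_Re_lt)
    then have "closed_segment (1/2) x \<subseteq> ?S"
      using x True by (intro closed_segment_subset) (auto simp: slit_plane_def)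
    then show ?thesis
      using y by (auto simp: slit_plane_def)
  next
    case False
    then show ?thesis
      using y half by (auto simp: slit_plane_def in_segment)
  qed
qed

lemma sin_pi_eq_0_complex: "sin (of_real pi * s) = 0 \<longleftrightarrow> s \<in> \<int>" for s :: complex
proof -
  have "complex_of_real pi * s = of_real (of_int n * pi) \<longleftrightarrow> s = of_int n" for n :: int
    by (auto simp: mult.commute)
  then show ?thesis
    by (auto simp: sin_eq_0 Ints_def)
qed

lemma slit_plane_not_Ints: "s \<notin> \<int>" if "s \<in> slit_plane"
  using that by (auto simp: slit_plane_def elim!: Ints_cases)

text \<open>The reverse triangle inequality for the two exponentials in sin w. On the half-lines Im
  s = \<plusminus>\<phi> it bounds \<pi> / sin (\<pi> s) uniformly in Re s.\<close>

lemma norm_sin_ge_sinh: "sinh \<bar>Im w\<bar> \<le> norm (sin w)" for w :: complex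
proof -
  have "\<bar>norm (exp (\<i> * w)) - norm (exp (- (\<i> * w)))\<bar> \<le> norm (exp (\<i> * w) - exp (- (\<i> * w)))"
    by (rule norm_triangle_ineq3)
  then show ?thesis
    by (simp add: sin_exp_eq norm_divide norm_mult sinh_field_def abs_if split: if_splits)
qed

text \<open>At these abscissae the real sine is \<plusminus>1, so the real part of sin (\<pi> s) has
  modulus cosh (\<pi> Im s). This controls vertical sides that cross the real axis, where the sinh
  bound degenerates to 0.\<close>

lemma norm_sin_pi_half_odd_ge:
  fixes s :: complex
  assumes "Re s = - (real n + 1/2)"
  shows "1/2 \<le> norm (sin (of_real pi * s))"
proof -
  define y where "y = Im (of_real pi * s)"
  have "Re (of_real pi * s) = - (real n * pi + pi / 2)"
    by (simp add: assms algebra_simps)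
  then have "\<bar>sin (Re (of_real pi * s))\<bar> = 1"
    by (simp only: sin_minus sin_add) (simp add: sin_npi cos_npi power_abs)
  then have "\<bar>Re (sin (of_real pi * s))\<bar> = (exp y + exp (- y)) / 2"
    unfolding Re_sin y_def by (simp add: abs_mult)
  moreover have "1/2 \<le> (exp y + exp (- y)) / 2"
    by (cases "0 \<le> y") (simp_all add: add_increasing add_increasing2)
  ultimately show ?thesis
    using abs_Re_le_cmod[of "sin (of_real pi * s)"] by linarith
qed

text \<open>The residue is the limit of \<open>?G s * (s - ?p)\<close>, governed by the derivative
  \<pi> (-1)^k of sin (\<pi> s) at -k. This also covers zeros of \<open>h\<close>, where the
  singularity is removable.\<close>

lemma residue_pi_over_sin:
  fixes h :: "complex \<Rightarrow> complex"
  assumes h: "h holomorphic_on UNIV"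
  shows "residue (\<lambda>s. of_real pi / sin (of_real pi * s) * h s) (- of_nat k) = (- 1) ^ k * h (- of_nat k)"
    (is "residue ?G ?p = _")
proof (rule residue_simple')
  show "open (ball ?p 1)" "?p \<in> ball ?p 1"
    by auto
  have "s \<notin> \<int>" if "s \<in> ball ?p 1 - {?p}" for s
  proof
    assume "s \<in> \<int>"
    then obtain n where n: "s = of_int n"
      by (elim Ints_cases)
    then have "norm (of_int (- int k - n) :: complex) < 1"
      using that by (simp add: dist_norm)
    then have "n = - int k"
      by (simp only: norm_of_int)
    then show False
      using that n by simp
  qed
  then show "?G holomorphic_on ball ?p 1 - {?p}"
    by (intro holomorphic_intros holomorphic_on_subset[OF h]) (auto simp: sin_pi_eq_0_complex)
  have cos: "cos (of_real pi * ?p) = (- 1) ^ k"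
  proof -
    have "cos (of_real pi * ?p) = of_real (cos (real k * pi))"
      by (simp add: cos_of_real[symmetric] mult.commute)
    then show ?thesis
      by (simp add: cos_npi)
  qed
  have "((\<lambda>s. sin (of_real pi * s)) has_field_derivative (of_real pi * (- 1) ^ k)) (at ?p)"
    by (rule derivative_eq_intros refl | simp only: cos)+ simp
  then have "((\<lambda>s. (sin (of_real pi * s) - sin (of_real pi * ?p)) / (s - ?p)) \<longlongrightarrow> of_real pi * (- 1) ^ k) (at ?p)"
    by (simp only: has_field_derivative_iff)
  moreover have "sin (of_real pi * ?p) = 0"
    unfolding sin_pi_eq_0_complex by simp
  ultimately have "((\<lambda>s. sin (of_real pi * s) / (s - ?p)) \<longlongrightarrow> of_real pi * (- 1) ^ k) (at ?p)"
    by (simp only: diff_0_right)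
  moreover have "(h \<longlongrightarrow> h ?p) (at ?p)"
    using holomorphic_on_imp_continuous_on[OF h] by (simp add: continuous_on_def)
  ultimately have "((\<lambda>s. of_real pi / (sin (of_real pi * s) / (s - ?p)) * h s)
      \<longlongrightarrow> of_real pi / (of_real pi * (- 1) ^ k) * h ?p) (at ?p)"
    by (intro tendsto_intros) auto
  moreover have "of_real pi / (of_real pi * (- 1) ^ k) * h ?p = (- 1) ^ k * h ?p"
    by (simp add: field_simps flip: power_mult_distrib)
  ultimately show "((\<lambda>s. ?G s * (s - ?p)) \<longlongrightarrow> (- 1) ^ k * h ?p) (at ?p)"
    by (simp add: mult_ac)
qed

lemma rectpath_pi_over_sin:
  fixes h :: "complex \<Rightarrow> complex"
  assumes h: "h holomorphic_on UNIV" and "0 < \<phi>" "0 < c" "c < 1"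
  defines "G \<equiv> \<lambda>s. of_real pi / sin (of_real pi * s) * h s"
  shows "contour_integral (rectpath (Complex (- (real n + 1/2)) (- \<phi>)) (Complex c \<phi>)) G =
         2 * of_real pi * \<i> * (\<Sum>k\<le>n. (- 1) ^ k * h (- of_nat k))"
proof -
  \<comment> \<open>A convex neighbourhood of the rectangle whose only integers are 0, -1, ...,
    -n.\<close>
  define S where "S = {s. - (real n + 1) < Re s} \<inter> {s. Re s < 1}"
  define pts where "pts = (\<lambda>k. - of_nat k :: complex) ` {..n}"
  let ?a = "Complex (- (real n + 1/2)) (- \<phi>)" and ?b = "Complex c \<phi>"
  let ?r = "rectpath ?a ?b"
  have le: "Re ?a \<le> Re ?b" "Im ?a \<le> Im ?b"
    using assms by auto
  have pts: "pts \<subseteq> box ?a ?b"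
    using assms by (auto simp: pts_def in_box_complex_iff)
  have "convex S" "open S"
    unfolding S_def by (auto intro!: convex_Int open_Int convex_halfspace_Re_gt convex_halfspace_Re_lt
        open_halfspace_Re_gt open_halfspace_Re_lt)
  have sub: "cbox ?a ?b \<subseteq> S"
    using assms by (auto simp: S_def in_cbox_complex_iff)
  have "s \<notin> \<int>" if s: "s \<in> S - pts" for s
  proof
    assume "s \<in> \<int>"
    then obtain m where m: "s = of_int m"
      by (elim Ints_cases)
    then have "real_of_int m < real_of_int 1" "real_of_int (- (int n + 1)) < real_of_int m"
      using s by (auto simp: S_def)
    then have "m < 1" "- (int n + 1) < m"
      unfolding of_int_less_iff by auto
    then have "s = - of_nat (nat (- m))" "nat (- m) \<le> n"
      using m by auto
    then show False
      using s by (auto simp: pts_def)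
  qed
  then have "G holomorphic_on S - pts"
    unfolding G_def
    by (intro holomorphic_intros holomorphic_on_subset[OF h]) (auto simp: sin_pi_eq_0_complex)
  moreover have "path_image ?r \<subseteq> S - pts"
    using path_image_rectpath_cbox_minus_box[OF le] sub pts by blast
  moreover have "\<forall>s. s \<notin> S \<longrightarrow> winding_number ?r s = 0"
    using winding_number_rectpath_outside[OF le] sub by blast
  ultimately have "contour_integral ?r G = 2 * pi * \<i> * (\<Sum>p\<in>pts. winding_number ?r p * residue G p)"
    using \<open>open S\<close> \<open>convex S\<close> convex_connected
    by (intro Residue_theorem) (auto simp: pts_def)
  also have "(\<Sum>p\<in>pts. winding_number ?r p * residue G p) = (\<Sum>p\<in>pts. residue G p)"
    using pts winding_number_rectpath by (intro sum.cong) auto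
  also have "\<dots> = (\<Sum>k\<le>n. residue G (- of_nat k))"
    unfolding pts_def by (subst sum.reindex) (auto simp: inj_on_def)
  finally show ?thesis
    unfolding G_def residue_pi_over_sin[OF h] by simp
qed

section \<open>Loop integrals as residue series\<close>

lemma contour_integral_linepath_primitive:
  assumes "\<And>s. s \<in> D \<Longrightarrow> (F has_field_derivative G s) (at s)" "closed_segment u v \<subseteq> D"
  shows "(G has_contour_integral (F v - F u)) (linepath u v)"
  using contour_integral_primitive[of D F G "linepath u v"] assms
  by (auto intro: has_field_derivative_at_within)

text \<open>
  A primitive \<open>F\<close> of the integrand on the slit plane evaluates the part of the loop right of
  \<open>b = -(n + 1/2)\<close> as \<open>F (b + \<i> \<phi>) - F (b - \<i> \<phi>)\<close>, whatever the finite piece \<open>g\<close> is; hence \<open>g\<close> and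
  the half-lines may be replaced by three sides of a rectangle, whose fourth side contributes
  \<open>O(exp b)\<close>.
\<close>
lemma loop_integral_residue_sums:
  fixes h :: "complex \<Rightarrow> complex"
  assumes loop: "left_loop \<phi> c a g" and h: "h holomorphic_on UNIV"
    and bound: "\<And>s. \<bar>Im s\<bar> \<le> \<phi> \<Longrightarrow> Re s \<le> max a 0 \<Longrightarrow> norm (h s) \<le> M * exp (Re s)"
  defines "G \<equiv> \<lambda>s. Gamma s * Gamma (1 - s) * h s"
  shows "loop_integrable \<phi> a g G"
    and "(\<lambda>k. (- 1) ^ k * h (- of_nat k)) sums (1 / (2 * of_real pi * \<i>) * loop_integral \<phi> a g G)"
proof -
  have \<phi>: "0 < \<phi>" and c: "0 < c" "c < 1" and g: "valid_path g"
    "pathstart g = Complex a (- \<phi>)" "pathfinish g = Complex a \<phi>"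
    and cross: "\<And>t. t \<in> {0..1} \<Longrightarrow> Im (g t) = 0 \<Longrightarrow> g t = of_real c"
    using loop by (auto simp: left_loop_def)
  have G: "G = (\<lambda>s. of_real pi / sin (of_real pi * s) * h s)"
    by (simp add: G_def Gamma_reflection_complex)
  \<comment> \<open>The range up to \<open>max a 0\<close> in the bound includes s = 0 here and,
    later, every left side Re s = -(n + 1/2), even one to the right of \<open>a\<close>.\<close>
  have "0 \<le> M"
    using order_trans[OF norm_ge_zero bound[of 0]] \<phi> by simp
  have "G holomorphic_on slit_plane"
    unfolding G using slit_plane_not_Ints
    by (intro holomorphic_intros holomorphic_on_subset[OF h]) (auto simp: sin_pi_eq_0_complex)
  then obtain F where F: "\<And>s. s \<in> slit_plane \<Longrightarrow> (F has_field_derivative G s) (at s)"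
    using holomorphic_starlike_primitive[OF _ starlike_slit_plane open_slit_plane finite.emptyI, of G]
      holomorphic_on_imp_continuous_on holomorphic_on_imp_differentiable_at[OF _ open_slit_plane]
    by (metis Diff_empty)

  have cont: "continuous_on {..a} (\<lambda>x. G (Complex x y))" if "y \<noteq> 0" for y
    unfolding Complex_eq
    by (intro continuous_on_compose2[OF holomorphic_on_imp_continuous_on[OF \<open>G holomorphic_on slit_plane\<close>]]
        continuous_intros) (use that in \<open>auto simp: slit_plane_def\<close>)
  have horizontal: "norm (G (Complex x y)) \<le> pi / sinh (pi * \<phi>) * M * exp x"
    if "\<bar>y\<bar> = \<phi>" "x \<le> a" for x y
  proof -
    have "sinh (pi * \<phi>) \<le> norm (sin (of_real pi * Complex x y))"
      using norm_sin_ge_sinh[of "of_real pi * Complex x y"] that by (simp add: abs_mult)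
    moreover have "0 < sinh (pi * \<phi>)"
      using \<phi> by simp
    moreover have "norm (h (Complex x y)) \<le> M * exp x"
      using bound[of "Complex x y"] that by simp
    ultimately have "pi / norm (sin (of_real pi * Complex x y)) * norm (h (Complex x y))
        \<le> pi / sinh (pi * \<phi>) * (M * exp x)"
      by (intro mult_mono divide_left_mono mult_pos_pos) auto
    then show ?thesis
      unfolding G norm_mult norm_divide by (simp add: mult_ac)
  qed
  note half_line = integrable_on_atMost_exp_bound[OF cont horizontal]
    tendsto_integral_atMost_exp_bound[OF cont horizontal]

  have "path_image g \<subseteq> slit_plane"
  proof
    fix s assume "s \<in> path_image g"
    then obtain t where "t \<in> {0..1}" "s = g t"
      by (auto simp: path_image_def)
    then show "s \<in> slit_plane"
      using cross[of t] c by (cases "Im s = 0") (auto simp: slit_plane_def)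
  qed
  then have int_g: "(G has_contour_integral (F (Complex a \<phi>) - F (Complex a (- \<phi>)))) g"
    using contour_integral_primitive[of slit_plane F G g] F g
    by (auto intro: has_field_derivative_at_within)
  show "loop_integrable \<phi> a g G"
    unfolding loop_integrable_def using half_line(1) int_g \<phi>
    by (auto simp: contour_integrable_on_def)

  define b where "b n = - (real n + 1/2)" for n :: nat
  define S where "S n = (\<Sum>k\<le>n. (- 1) ^ k * h (- of_nat k))" for n
  define l where "l n = linepath (Complex (b n) \<phi>) (Complex (b n) (- \<phi>))" for n
  have ftc: "integral {b n..a} (\<lambda>x. G (Complex x y)) = F (Complex a y) - F (Complex (b n) y)"
    if "b n \<le> a" "y \<noteq> 0" for n y
  proof (rule integral_unique, rule fundamental_theorem_of_calculus[OF \<open>b n \<le> a\<close>])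
    fix x
    have "((\<lambda>x. Complex x y) has_vector_derivative 1) (at x)"
      unfolding Complex_eq by (auto intro!: derivative_eq_intros)
    moreover have "(F has_field_derivative G (Complex x y)) (at (Complex x y))"
      using that by (intro F) (auto simp: slit_plane_def)
    ultimately have "(F \<circ> (\<lambda>x. Complex x y) has_vector_derivative 1 * G (Complex x y)) (at x)"
      by (rule field_vector_diff_chain_at)
    then show "((\<lambda>x. F (Complex x y)) has_vector_derivative G (Complex x y)) (at x within {b n..a})"
      by (simp add: o_def has_vector_derivative_at_within)
  qed
  have segment: "Re s = b n \<and> \<bar>Im s\<bar> \<le> \<phi>"
    if "s \<in> closed_segment (Complex (b n) \<phi>) (Complex (b n) (- \<phi>))" for s n
    using that \<phi> by (auto simp: closed_segment_same_Re closed_segment_eq_real_ivl)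
  have not_Ints: "sin (of_real pi * s) \<noteq> 0" if "Re s = b n" for s n
    using norm_sin_pi_half_odd_ge[of s n] that by (auto simp: b_def)
  have int_l: "G contour_integrable_on l n" for n
    unfolding l_def G
    by (intro contour_integrable_continuous_linepath continuous_intros
        continuous_on_subset[OF holomorphic_on_imp_continuous_on[OF h]])
      (use segment not_Ints in auto)
  \<comment> \<open>Three sides lie in the slit plane, and their increments of \<open>F\<close>
    telescope.\<close>
  have rect: "2 * of_real pi * \<i> * S n =
      F (Complex (b n) \<phi>) - F (Complex (b n) (- \<phi>)) + contour_integral (l n) G" for n
  proof -
    have "(G has_contour_integral (F (Complex c (- \<phi>)) - F (Complex (b n) (- \<phi>))))
        (linepath (Complex (b n) (- \<phi>)) (Complex c (- \<phi>)))"
      "(G has_contour_integral (F (Complex c \<phi>) - F (Complex c (- \<phi>))))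
        (linepath (Complex c (- \<phi>)) (Complex c \<phi>))"
      "(G has_contour_integral (F (Complex (b n) \<phi>) - F (Complex c \<phi>)))
        (linepath (Complex c \<phi>) (Complex (b n) \<phi>))"
      using \<phi> c by (auto intro!: contour_integral_linepath_primitive[OF F]
          simp: closed_segment_same_Re closed_segment_same_Im slit_plane_def)
    moreover have "(G has_contour_integral (contour_integral (l n) G)) (l n)"
      using int_l by (rule has_contour_integral_integral)
    ultimately have "(G has_contour_integral
        ((F (Complex c (- \<phi>)) - F (Complex (b n) (- \<phi>))) + ((F (Complex c \<phi>) - F (Complex c (- \<phi>)))
          + ((F (Complex (b n) \<phi>) - F (Complex c \<phi>)) + contour_integral (l n) G))))
        (rectpath (Complex (b n) (- \<phi>)) (Complex c \<phi>))"
      unfolding rectpath_def Let_def l_def complex.sel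
      by (intro has_contour_integral_join valid_path_join valid_path_linepath) auto
    from contour_integral_unique[OF this] show ?thesis
      unfolding S_def b_def G rectpath_pi_over_sin[OF h \<phi> c] by simp
  qed
  have l_to_0: "(\<lambda>n. contour_integral (l n) G) \<longlonglongrightarrow> 0"
  proof (rule Lim_null_comparison)
    \<comment> \<open>Here 2 \<pi> is \<pi> divided by the lower bound 1/2 for the sine, and 2
      \<phi> is the length of the side.\<close>
    have "norm (contour_integral (l n) G) \<le> 2 * pi * M * exp (b n) * (2 * \<phi>)" for n
    proof -
      have "norm (G s) \<le> 2 * pi * M * exp (b n)"
        if "s \<in> closed_segment (Complex (b n) \<phi>) (Complex (b n) (- \<phi>))" for s
      proof -
        have "norm (h s) \<le> M * exp (b n)"
          using bound[of s] segment[OF that] by (auto simp: b_def)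
        moreover have "1/2 \<le> norm (sin (of_real pi * s))"
          using norm_sin_pi_half_odd_ge[of s n] segment[OF that] by (simp add: b_def)
        ultimately have "pi / norm (sin (of_real pi * s)) * norm (h s) \<le> pi / (1/2) * (M * exp (b n))"
          by (intro mult_mono divide_left_mono mult_pos_pos) auto
        then show ?thesis
          unfolding G norm_mult norm_divide by (simp add: mult_ac)
      qed
      then have "norm (contour_integral (l n) G)
          \<le> 2 * pi * M * exp (b n) * norm (Complex (b n) (- \<phi>) - Complex (b n) \<phi>)"
        using int_l[of n] \<open>0 \<le> M\<close> unfolding l_def by (intro contour_integral_bound_linepath) auto
      also have "norm (Complex (b n) (- \<phi>) - Complex (b n) \<phi>) = 2 * \<phi>"
        using \<phi> by (simp add: cmod_eq_Im)
      finally show ?thesis .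
    qed
    then show "\<forall>\<^sub>F n in sequentially.
        norm (contour_integral (l n) G) \<le> 2 * pi * M * exp (b n) * (2 * \<phi>)"
      by simp
    have "(\<lambda>n. exp (b n)) \<longlonglongrightarrow> 0"
      unfolding b_def by real_asymp
    then show "(\<lambda>n. 2 * pi * M * exp (b n) * (2 * \<phi>)) \<longlonglongrightarrow> 0"
      by (intro tendsto_mult_left_zero tendsto_mult_right_zero)
  qed

  \<comment> \<open>The loop truncated at \<open>b n\<close> and closed by the left side. Once
    \<open>b n \<le> a\<close>, the values of \<open>F\<close> above and below \<open>a\<close>
    cancel and the formula in \<open>rect\<close> remains.\<close>
  define T where "T n = integral {b n..a} (\<lambda>x. G (Complex x (- \<phi>))) + contour_integral g G
      - integral {b n..a} (\<lambda>x. G (Complex x \<phi>)) + contour_integral (l n) G" for n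
  have "T \<longlonglongrightarrow> loop_integral \<phi> a g G + 0"
    unfolding T_def loop_integral_def b_def using half_line(2)[of "- \<phi>"] half_line(2)[of \<phi>] \<phi>
    by (intro tendsto_intros l_to_0[unfolded b_def]) auto
  moreover have "\<forall>\<^sub>F n in sequentially. T n = 2 * of_real pi * \<i> * S n"
  proof -
    obtain N :: nat where "- a \<le> real N"
      using real_arch_simple by blast
    then have "b n \<le> a" if "n \<ge> N" for n
      using that by (simp add: b_def)
    then have "T n = 2 * of_real pi * \<i> * S n" if "n \<ge> N" for n
      using that \<phi> unfolding T_def rect contour_integral_unique[OF int_g] by (simp add: ftc)
    then show ?thesis
      unfolding eventually_sequentially by blast
  qed
  ultimately have "(\<lambda>n. 2 * of_real pi * \<i> * S n) \<longlonglongrightarrow> loop_integral \<phi> a g G"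
    using Lim_transform_eventually by force
  then have "(\<lambda>n. 1 / (2 * of_real pi * \<i>) * (2 * of_real pi * \<i> * S n))
      \<longlonglongrightarrow> 1 / (2 * of_real pi * \<i>) * loop_integral \<phi> a g G"
    by (rule tendsto_mult_left)
  then show "(\<lambda>k. (- 1) ^ k * h (- of_nat k)) sums (1 / (2 * of_real pi * \<i>) * loop_integral \<phi> a g G)"
    by (simp add: sums_def_le S_def)
qed

section \<open>The Mellin-Barnes integrands\<close>

text \<open>At integers every branch gives the same power, since the exponential of any logarithm of
  -z is -z.\<close>

lemma neg_power_minus_of_nat:
  assumes "is_Arg (- z) \<theta>" "z \<noteq> 0"
  shows "neg_power z \<theta> (- of_nat k) = (- z) ^ k"
proof -
  have "exp (of_real (ln (norm z)) + \<i> * of_real \<theta>) = - z"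
    using assms by (simp add: is_Arg_def exp_add exp_of_real)
  then show ?thesis
    by (simp add: neg_power_def exp_of_nat_mult)
qed

lemma norm_neg_power_le:
  assumes "\<bar>Im s\<bar> \<le> \<phi>"
  shows "norm (neg_power z \<theta> s) \<le> exp (\<phi> * \<bar>\<theta>\<bar>) * exp (- ln (norm z) * Re s)"
proof -
  have "Im s * \<theta> \<le> \<bar>Im s\<bar> * \<bar>\<theta>\<bar>"
    by (metis abs_ge_self abs_mult)
  also have "\<dots> \<le> \<phi> * \<bar>\<theta>\<bar>"
    using assms by (intro mult_right_mono) auto
  finally show ?thesis
    by (simp add: neg_power_def algebra_simps flip: exp_add)
qed

text \<open>As \<alpha> > 0, a left half-strip in s becomes a right half-strip in w = \<beta> -
  \<alpha> s, where the decay of \<open>P\<close> outweighs the exponential size of the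
  power.\<close>

lemma strip_decay_neg_power_bound:
  assumes "strip_decay P" "\<alpha> > 0"
  obtains M where "0 \<le> M" "\<And>s. \<bar>Im s\<bar> \<le> \<phi> \<Longrightarrow> Re s \<le> R \<Longrightarrow>
    norm (P (of_real \<beta> - of_real \<alpha> * s) * neg_power z \<theta> s) \<le> M * exp (A * Re s)"
proof -
  \<comment> \<open>Solves -\<alpha> B - ln |z| = A, so that the total rate in Re s is
    \<open>A\<close>.\<close>
  define B where "B = - (A + ln (norm z)) / \<alpha>"
  obtain C where C: "C \<ge> 0"
    "\<And>w. \<bar>Im w\<bar> \<le> \<alpha> * \<phi> \<Longrightarrow> \<beta> - \<alpha> * R \<le> Re w \<Longrightarrow> norm (P w) \<le> C * exp (B * Re w)"
    using strip_decayE[OF assms(1)] by blast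
  show thesis
  proof (rule that)
    show "0 \<le> C * exp (B * \<beta>) * exp (\<phi> * \<bar>\<theta>\<bar>)"
      using C by simp
    fix s assume s: "\<bar>Im s\<bar> \<le> \<phi>" "Re s \<le> R"
    have "norm (P (of_real \<beta> - of_real \<alpha> * s)) \<le> C * exp (B * (\<beta> - \<alpha> * Re s))"
      using C(2)[of "of_real \<beta> - of_real \<alpha> * s"] s \<open>\<alpha> > 0\<close> by (simp add: abs_mult)
    then have "norm (P (of_real \<beta> - of_real \<alpha> * s) * neg_power z \<theta> s)
        \<le> C * exp (B * (\<beta> - \<alpha> * Re s)) * (exp (\<phi> * \<bar>\<theta>\<bar>) * exp (- ln (norm z) * Re s))"
      unfolding norm_mult using norm_neg_power_le[OF s(1)] C(1) by (intro mult_mono) auto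
    also have "\<dots> = C * exp (\<phi> * \<bar>\<theta>\<bar>) * exp (B * (\<beta> - \<alpha> * Re s) + - ln (norm z) * Re s)"
      by (simp only: exp_add mult_ac)
    also have "B * (\<beta> - \<alpha> * Re s) + - ln (norm z) * Re s = B * \<beta> + A * Re s"
      using \<open>\<alpha> > 0\<close> by (simp add: B_def field_simps)
    finally show "norm (P (of_real \<beta> - of_real \<alpha> * s) * neg_power z \<theta> s)
        \<le> C * exp (B * \<beta>) * exp (\<phi> * \<bar>\<theta>\<bar>) * exp (A * Re s)"
      by (simp add: exp_add mult_ac)
  qed
qed

text \<open>Common form of the three integrals: \<open>P\<close> is \<open>rGamma\<close> or
  \<open>Digamma_rGamma\<close>, and \<open>p\<close> is 1 or s.\<close>

lemma loop_integral_strip_decay_sums: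
  fixes P p :: "complex \<Rightarrow> complex" and \<beta> :: real
  assumes "left_loop \<phi> c a g" "is_Arg (- z) \<theta>" "z \<noteq> 0" "\<alpha> > 0"
    and P: "strip_decay P" "P holomorphic_on UNIV"
    and p: "p holomorphic_on UNIV" "\<And>s. norm (p s) \<le> 1 + norm s"
  defines "G \<equiv> \<lambda>s. p s * P (of_real \<beta> - of_real \<alpha> * s) * Gamma s * Gamma (1 - s) * neg_power z \<theta> s"
  shows "loop_integrable \<phi> a g G"
    and "(\<lambda>k. z ^ k * p (- of_nat k) * P (of_real (\<alpha> * real k + \<beta>))) sums
           (1 / (2 * of_real pi * \<i>) * loop_integral \<phi> a g G)"
proof -
  define h where "h s = p s * (P (of_real \<beta> - of_real \<alpha> * s) * neg_power z \<theta> s)" for s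
  define R where "R = max a 0"
  have G: "G = (\<lambda>s. Gamma s * Gamma (1 - s) * h s)"
    by (simp add: G_def h_def mult_ac)
  have "(P \<circ> (\<lambda>s. of_real \<beta> - of_real \<alpha> * s)) holomorphic_on UNIV"
    by (intro holomorphic_on_compose_gen[OF _ P(2)] holomorphic_intros) auto
  then have h: "h holomorphic_on UNIV"
    unfolding h_def neg_power_def o_def by (intro holomorphic_intros p)
  \<comment> \<open>Rate 2 leaves one factor \<open>exp (Re s)\<close> to absorb the linear growth
    of \<open>p\<close> and one for the required bound.\<close>
  obtain M where M: "0 \<le> M" "\<And>s. \<bar>Im s\<bar> \<le> \<phi> \<Longrightarrow> Re s \<le> R \<Longrightarrow>
      norm (P (of_real \<beta> - of_real \<alpha> * s) * neg_power z \<theta> s) \<le> M * exp (2 * Re s)"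
    using strip_decay_neg_power_bound[OF P(1) \<open>\<alpha> > 0\<close>] by blast
  have bound: "norm (h s) \<le> exp (1 + \<phi> + 2 * R) * M * exp (Re s)"
    if s: "\<bar>Im s\<bar> \<le> \<phi>" "Re s \<le> max a 0" for s
  proof -
    have "norm (p s) \<le> 1 + \<phi> + \<bar>Re s\<bar>"
      using p(2)[of s] cmod_le[of s] s by linarith
    also have "\<dots> \<le> exp (1 + \<phi> + \<bar>Re s\<bar>)"
      using exp_ge_add_one_self[of "1 + \<phi> + \<bar>Re s\<bar>"] by linarith
    \<comment> \<open>Uses |Re s| \<le> 2 R - Re s, valid because Re s \<le> R and R \<ge>
      0.\<close>
    also have "\<dots> \<le> exp (1 + \<phi> + 2 * R - Re s)"
      using s by (auto simp: R_def)
    finally have "norm (h s) \<le> exp (1 + \<phi> + 2 * R - Re s) * (M * exp (2 * Re s))"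
      unfolding h_def norm_mult[of "p s"] using M s by (intro mult_mono) (auto simp: R_def)
    also have "\<dots> = M * exp (1 + \<phi> + 2 * R - Re s + 2 * Re s)"
      by (simp only: exp_add mult_ac)
    also have "1 + \<phi> + 2 * R - Re s + 2 * Re s = 1 + \<phi> + 2 * R + Re s"
      by simp
    finally show ?thesis
      by (simp only: exp_add mult_ac)
  qed
  have "(- 1) ^ k * h (- of_nat k) = z ^ k * p (- of_nat k) * P (of_real (\<alpha> * real k + \<beta>))" for k
  proof -
    have "(- 1) ^ k * (- z) ^ k = z ^ k"
      by (simp flip: power_mult_distrib)
    then show ?thesis
      by (simp add: h_def neg_power_minus_of_nat[OF assms(2,3)] mult_ac add.commute)
  qed
  then show "loop_integrable \<phi> a g G"
    "(\<lambda>k. z ^ k * p (- of_nat k) * P (of_real (\<alpha> * real k + \<beta>))) sums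
       (1 / (2 * of_real pi * \<i>) * loop_integral \<phi> a g G)"
    using loop_integral_residue_sums[OF assms(1) h bound] unfolding G by simp_all
qed

section \<open>The integral representation and both parameter derivatives\<close>

theorem proposition3p1:
  fixes \<alpha> \<beta> \<theta> \<phi> c a :: real and z :: complex and g :: "real \<Rightarrow> complex"
  assumes "\<alpha> > 0" and "\<beta> \<ge> 0"
    and "z \<noteq> 0" and "\<bar>Arg z\<bar> < pi"
    and "is_Arg (- z) \<theta>"
    and "left_loop \<phi> c a g"
  defines "f \<equiv> \<lambda>s. Gamma s * Gamma (1 - s) * rGamma (of_real \<beta> - of_real \<alpha> * s)
                    * neg_power z \<theta> s"
    and "f\<^sub>\<alpha> \<equiv> \<lambda>s. s * Digamma_rGamma (of_real \<beta> - of_real \<alpha> * s) * Gamma s * Gamma (1 - s)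
                    * neg_power z \<theta> s"
    and "f\<^sub>\<beta> \<equiv> \<lambda>s. Digamma_rGamma (of_real \<beta> - of_real \<alpha> * s) * Gamma s * Gamma (1 - s)
                    * neg_power z \<theta> s"
  shows "loop_integrable \<phi> a g f \<and>
         mittag_leffler \<alpha> \<beta> z = 1 / (2 * of_real pi * \<i>) * loop_integral \<phi> a g f \<and>
         loop_integrable \<phi> a g f\<^sub>\<alpha> \<and>
         ((\<lambda>x. mittag_leffler x \<beta> z) has_vector_derivative
            1 / (2 * of_real pi * \<i>) * loop_integral \<phi> a g f\<^sub>\<alpha>) (at \<alpha>) \<and>
         loop_integrable \<phi> a g f\<^sub>\<beta> \<and>
         ((\<lambda>y. mittag_leffler \<alpha> y z) has_vector_derivative
            - (1 / (2 * of_real pi * \<i>)) * loop_integral \<phi> a g f\<^sub>\<beta>) (at \<beta>)"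
proof -
  have Digamma: "Digamma_rGamma = (\<lambda>w. - deriv rGamma w)"
    by (simp add: fun_eq_iff Digamma_rGamma_def)
  have D: "strip_decay Digamma_rGamma" "Digamma_rGamma holomorphic_on UNIV"
    unfolding Digamma using strip_decay_deriv[OF strip_decay_rGamma holomorphic_rGamma]
    by (auto simp: strip_decay_def intro!: holomorphic_intros holomorphic_rGamma)
  note sums = loop_integral_strip_decay_sums[OF assms(6,5,3,1)]

  have f: "f = (\<lambda>s. 1 * rGamma (of_real \<beta> - of_real \<alpha> * s) * Gamma s * Gamma (1 - s) * neg_power z \<theta> s)"
    by (simp add: f_def mult_ac)
  note sums_f = sums[OF strip_decay_rGamma holomorphic_rGamma, where p = "\<lambda>_. 1" and \<beta> = \<beta>, folded f]
  have 1: "loop_integrable \<phi> a g f"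
    using sums_f(1) by simp
  have 2: "mittag_leffler \<alpha> \<beta> z = 1 / (2 * of_real pi * \<i>) * loop_integral \<phi> a g f"
    using sums_f(2) by (simp add: mittag_leffler_def sums_iff)

  note sums_\<alpha> = sums[OF D, where p = "\<lambda>s. s" and \<beta> = \<beta>, folded f\<^sub>\<alpha>_def]
  have 3: "loop_integrable \<phi> a g f\<^sub>\<alpha>"
    using sums_\<alpha>(1) by simp
  have "((\<lambda>x. \<Sum>k. z ^ k * rGamma (of_real (\<beta> + real k * x))) has_vector_derivative
      (\<Sum>k. z ^ k * of_real (real k) * deriv rGamma (of_real (\<beta> + real k * \<alpha>)))) (at \<alpha>)"
  proof (rule has_vector_derivative_suminf_rGamma)
    \<comment> \<open>Keeping x above \<alpha>/2 makes the arguments grow at least like k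
      \<alpha>/2, uniformly near \<alpha>.\<close>
    show "convex {\<alpha>/2<..}" "open {\<alpha>/2<..}" "\<alpha> \<in> {\<alpha>/2<..}" "0 < \<alpha>/2"
      using \<open>\<alpha> > 0\<close> by auto
    show "\<alpha>/2 * real k - 0 \<le> \<beta> + real k * x" if "x \<in> {\<alpha>/2<..}" for k x
      using mult_right_mono[of "\<alpha>/2" x "real k"] that \<open>\<beta> \<ge> 0\<close> by (simp add: mult.commute)
  qed auto
  \<comment> \<open>The factor s equals -k at the pole -k; its sign cancels the one in
    \<open>Digamma_rGamma\<close>. For \<beta> there is no such factor, and the minus sign
    stays.\<close>
  moreover have "(\<Sum>k. z ^ k * of_real (real k) * deriv rGamma (of_real (\<beta> + real k * \<alpha>))) =
      1 / (2 * of_real pi * \<i>) * loop_integral \<phi> a g f\<^sub>\<alpha>"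
    using sums_\<alpha>(2) by (simp add: sums_iff Digamma_rGamma_def mult_ac add.commute)
  ultimately have 4: "((\<lambda>x. mittag_leffler x \<beta> z) has_vector_derivative
      1 / (2 * of_real pi * \<i>) * loop_integral \<phi> a g f\<^sub>\<alpha>) (at \<alpha>)"
    by (simp add: mittag_leffler_def mult.commute add.commute)

  have f\<^sub>\<beta>: "f\<^sub>\<beta> = (\<lambda>s. 1 * Digamma_rGamma (of_real \<beta> - of_real \<alpha> * s) * Gamma s * Gamma (1 - s)
      * neg_power z \<theta> s)"
    by (simp add: f\<^sub>\<beta>_def)
  note sums_\<beta> = sums[OF D, where p = "\<lambda>_. 1" and \<beta> = \<beta>, folded f\<^sub>\<beta>]
  have 5: "loop_integrable \<phi> a g f\<^sub>\<beta>"
    using sums_\<beta>(1) by simp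
  have "((\<lambda>y. \<Sum>k. z ^ k * rGamma (of_real (\<alpha> * real k + 1 * y))) has_vector_derivative
      (\<Sum>k. z ^ k * of_real 1 * deriv rGamma (of_real (\<alpha> * real k + 1 * \<beta>)))) (at \<beta>)"
  proof (rule has_vector_derivative_suminf_rGamma)
    \<comment> \<open>The ray from -1 is a neighbourhood even of \<beta> = 0, so the derivative
      there is two-sided.\<close>
    show "convex {- 1 :: real<..}" "open {- 1 :: real<..}" "\<beta> \<in> {- 1<..}" "0 < \<alpha>"
      using \<open>\<beta> \<ge> 0\<close> \<open>\<alpha> > 0\<close> by auto
    show "\<alpha> * real k - 1 \<le> \<alpha> * real k + 1 * y" if "y \<in> {- 1<..}" for k y
      using that by simp
  qed auto
  moreover have "(\<Sum>k. z ^ k * of_real 1 * deriv rGamma (of_real (\<alpha> * real k + 1 * \<beta>))) =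
      - (1 / (2 * of_real pi * \<i>)) * loop_integral \<phi> a g f\<^sub>\<beta>"
    using sums_minus[OF sums_\<beta>(2)] by (simp add: sums_iff Digamma_rGamma_def)
  ultimately have 6: "((\<lambda>y. mittag_leffler \<alpha> y z) has_vector_derivative
      - (1 / (2 * of_real pi * \<i>)) * loop_integral \<phi> a g f\<^sub>\<beta>) (at \<beta>)"
    by (simp add: mittag_leffler_def)
  from 1 2 3 4 5 6 show ?thesis
    by blast
qed

end
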